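(* Let $\alpha\ge 0$ be real and $d,k,\gamma>0$. The free boundary problems (P1) (convective condition) and (P3) (flux condition) described in the context are equivalent, in the following sense. (a) Let $h_0,T_\infty>0$ be data of problem (P1), with solution $(\Psi,s)$, $s(t)=2\nu\sqrt{dt}$. If the datum $c$ of problem (P3) is given by $$c=\frac{h_0T_\infty M\left(-\frac{\alpha}{2},\frac12,-\nu^2\right)}{M\left(-\frac{\alpha}{2},\frac12,-\nu^2\right)+\frac{2\sqrt d\,h_0}{k}\,\nu M\left(-\frac{\alpha}{2}+\frac12,\frac32,-\nu^2\right)},$$ then the solution $(T,q)$ of (P3) with this $c$ coincides with the solution of (P1): $T=\Psi$ and $q=s$. (b) Let $c>0$ be the datum of problem (P3), with solution $(T,q)$, $q(t)=2\lambda\sqrt{dt}$. If the data $T_\infty,h_0$ of problem (P1) satisfy $$T_\infty>\frac{2c\sqrt d}{k}\,\frac{\lambda M\left(-\frac{\alpha}{2}+\frac12,\frac32,-\lambda^2\right)}{M\left(-\frac{\alpha}{2},\frac12,-\lambda^2\right)}$$ and $$h_0=\frac{-cM\left(-\frac{\alpha}{2},\frac12,-\lambda^2\right)}{\frac{2c\sqrt d}{k}\lambda M\left(-\frac{\alpha}{2}+\frac12,\frac32,-\lambda^2\right)-T_\infty M\left(-\frac{\alpha}{2},\frac12,-\lambda^2\right)},$$ then the solution $(\Psi,s)$ of (P1) with these $h_0,T_\infty$ coincides with the solution of (P3): $\Psi=T$ and $s=q$.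
   Context: $M(a,b,z)$ is the Kummer function $M(a,b,z)=\sum_{j=0}^{\infty}\frac{(a)_j}{(b)_j\,j!}z^j$, where $(a)_0=1$ and $(a)_j=a(a+1)\cdots(a+j-1)$. Throughout $\eta=x/(2\sqrt{dt})$. Problem (P1), with data $h_0>0$, $T_\infty>0$: find $\Psi(x,t)$ and $s(t)$ with $\Psi_t=d\Psi_{xx}$ for $0<x<s(t)$, $t>0$; $s(0)=0$; and, for $t>0$, $\Psi(s(t),t)=0$, $k\Psi_x(0,t)=h_0t^{-1/2}[\Psi(0,t)-T_\infty t^{\alpha/2}]$, $k\Psi_x(s(t),t)=-\gamma s(t)^\alpha\dot s(t)$. Its (similarity) solution is $$\Psi(x,t)=t^{\alpha/2}\left[c_{11}M\left(-\tfrac{\alpha}{2},\tfrac12,-\eta^2\right)+c_{21}\eta M\left(-\tfrac{\alpha}{2}+\tfrac12,\tfrac32,-\eta^2\right)\right],\quad s(t)=2\nu\sqrt{dt},$$ $$c_{11}=\frac{-\nu M\left(-\frac{\alpha}{2}+\frac12,\frac32,-\nu^2\right)}{M\left(-\frac{\alpha}{2},\frac12,-\nu^2\right)}c_{21},\quad c_{21}=\frac{-2h_0\sqrt d\,T_\infty M\left(-\frac{\alpha}{2},\frac12,-\nu^2\right)}{kM\left(-\frac{\alpha}{2},\frac12,-\nu^2\right)+2\sqrt d\,h_0\nu M\left(-\frac{\alpha}{2}+\frac12,\frac32,-\nu^2\right)},$$ where $\nu$ is the unique positive solution of $\frac{h_0T_\infty}{\gamma2^\alpha d^{(\alpha+1)/2}}f_1(x)=x^{\alpha+1}$,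 $x>0$, with $f_1(x)=\left[M\left(\frac{\alpha}{2}+\frac12,\frac12,x^2\right)+2\frac{\sqrt d\,h_0}{k}xM\left(\frac{\alpha}{2}+1,\frac32,x^2\right)\right]^{-1}$. Problem (P3), with datum $c>0$: find $T(x,t)$ and $q(t)$ with $T_t=dT_{xx}$ for $0<x<q(t)$, $t>0$; $q(0)=0$; and, for $t>0$, $T(q(t),t)=0$, $kT_x(0,t)=-ct^{(\alpha-1)/2}$, $kT_x(q(t),t)=-\gamma q(t)^\alpha\dot q(t)$. Its (similarity) solution is $$T(x,t)=t^{\alpha/2}\left[c_{13}M\left(-\tfrac{\alpha}{2},\tfrac12,-\eta^2\right)+c_{23}\eta M\left(-\tfrac{\alpha}{2}+\tfrac12,\tfrac32,-\eta^2\right)\right],\quad q(t)=2\lambda\sqrt{dt},$$ $$c_{13}=\frac{-\lambda M\left(-\frac{\alpha}{2}+\frac12,\frac32,-\lambda^2\right)}{M\left(-\frac{\alpha}{2},\frac12,-\lambda^2\right)}c_{23},\qquad c_{23}=\frac{-2c\sqrt d}{k},$$ where $\lambda$ is the unique positive solution of $\frac{c}{\gamma2^\alpha d^{(\alpha+1)/2}}f_3(x)=x^{\alpha+1}$, $x>0$, with $f_3(x)=\left[M\left(\frac{\alpha}{2}+\frac12,\frac12,x^2\right)\right]^{-1}$. *)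

theory Defs
  imports Complex_Main
begin

definition kummer_M :: "real \<Rightarrow> real \<Rightarrow> real \<Rightarrow> real" where
  "kummer_M a b z = (\<Sum>j. pochhammer a j / (pochhammer b j * fact j) * z ^ j)"

text \<open>
  The conditions common to both problems. The argument \<open>Ux\<close> is the space derivative of \<open>U\<close> on the
  closed interval \<open>[0, r t]\<close>; it is one-sided at the two end points, which is the meaning of the
  boundary fluxes. For interior \<open>x\<close> the derivative within the interval is the ordinary one.
  Real powers are written with \<open>powr\<close>; all bases are positive, since \<open>t > 0\<close> and \<open>r t > 0\<close>.
\<close>

definition free_boundary_core ::
  "real \<Rightarrow> real \<Rightarrow> real \<Rightarrow> real \<Rightarrow> (real \<Rightarrow> real \<Rightarrow> real) \<Rightarrow> (real \<Rightarrow> real \<Rightarrow> real) \<Rightarrow> (real \<Rightarrow> real) \<Rightarrow> bool"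
where
  "free_boundary_core \<alpha> d k \<gamma> U Ux r \<longleftrightarrow>
     r 0 = 0 \<and>
     (\<forall>t>0. 0 < r t) \<and>
     (\<forall>t>0. \<forall>x\<in>{0..r t}. ((\<lambda>y. U y t) has_real_derivative Ux x t) (at x within {0..r t})) \<and>
     (\<forall>t>0. \<forall>x\<in>{0<..<r t}. \<exists>Ut Uxx.
        ((\<lambda>\<tau>. U x \<tau>) has_real_derivative Ut) (at t) \<and>
        ((\<lambda>y. Ux y t) has_real_derivative Uxx) (at x) \<and>
        Ut = d * Uxx) \<and>
     (\<forall>t>0. U (r t) t = 0) \<and>
     (\<forall>t>0. \<exists>r'. (r has_real_derivative r') (at t) \<and>
        k * Ux (r t) t = - \<gamma> * r t powr \<alpha> * r')"

definition solves_P1 ::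
  "real \<Rightarrow> real \<Rightarrow> real \<Rightarrow> real \<Rightarrow> real \<Rightarrow> real \<Rightarrow> (real \<Rightarrow> real \<Rightarrow> real) \<Rightarrow> (real \<Rightarrow> real) \<Rightarrow> bool"
where
  "solves_P1 \<alpha> d k \<gamma> h0 Tinf \<Psi> s \<longleftrightarrow>
     (\<exists>\<Psi>x. free_boundary_core \<alpha> d k \<gamma> \<Psi> \<Psi>x s \<and>
        (\<forall>t>0. k * \<Psi>x 0 t = h0 * t powr (-1/2) * (\<Psi> 0 t - Tinf * t powr (\<alpha>/2))))"

definition solves_P3 ::
  "real \<Rightarrow> real \<Rightarrow> real \<Rightarrow> real \<Rightarrow> real \<Rightarrow> (real \<Rightarrow> real \<Rightarrow> real) \<Rightarrow> (real \<Rightarrow> real) \<Rightarrow> bool"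
where
  "solves_P3 \<alpha> d k \<gamma> c T q \<longleftrightarrow>
     (\<exists>Tx. free_boundary_core \<alpha> d k \<gamma> T Tx q \<and>
        (\<forall>t>0. k * Tx 0 t = - c * t powr ((\<alpha> - 1)/2)))"

definition similarity_temp :: "real \<Rightarrow> real \<Rightarrow> real \<Rightarrow> real \<Rightarrow> real \<Rightarrow> real \<Rightarrow> real" where
  "similarity_temp \<alpha> d c1 c2 x t =
     (let \<eta> = x / (2 * sqrt (d * t)) in
      t powr (\<alpha>/2) *
        (c1 * kummer_M (-\<alpha>/2) (1/2) (-\<eta>\<^sup>2) + c2 * \<eta> * kummer_M (-\<alpha>/2 + 1/2) (3/2) (-\<eta>\<^sup>2)))"

definition P1_f :: "real \<Rightarrow> real \<Rightarrow> real \<Rightarrow> real \<Rightarrow> real \<Rightarrow> real" where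
  "P1_f \<alpha> d k h0 x =
     inverse (kummer_M (\<alpha>/2 + 1/2) (1/2) (x\<^sup>2)
              + 2 * (sqrt d * h0 / k) * x * kummer_M (\<alpha>/2 + 1) (3/2) (x\<^sup>2))"

definition P1_nu :: "real \<Rightarrow> real \<Rightarrow> real \<Rightarrow> real \<Rightarrow> real \<Rightarrow> real \<Rightarrow> real" where
  "P1_nu \<alpha> d k \<gamma> h0 Tinf =
     (THE x. 0 < x \<and>
        h0 * Tinf / (\<gamma> * 2 powr \<alpha> * d powr ((\<alpha> + 1)/2)) * P1_f \<alpha> d k h0 x = x powr (\<alpha> + 1))"

definition P1_c2 :: "real \<Rightarrow> real \<Rightarrow> real \<Rightarrow> real \<Rightarrow> real \<Rightarrow> real \<Rightarrow> real" where
  "P1_c2 \<alpha> d k h0 Tinf \<nu> =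
     - 2 * h0 * sqrt d * Tinf * kummer_M (-\<alpha>/2) (1/2) (-\<nu>\<^sup>2) /
       (k * kummer_M (-\<alpha>/2) (1/2) (-\<nu>\<^sup>2)
        + 2 * sqrt d * h0 * \<nu> * kummer_M (-\<alpha>/2 + 1/2) (3/2) (-\<nu>\<^sup>2))"

definition P1_c1 :: "real \<Rightarrow> real \<Rightarrow> real \<Rightarrow> real \<Rightarrow> real \<Rightarrow> real \<Rightarrow> real" where
  "P1_c1 \<alpha> d k h0 Tinf \<nu> =
     - \<nu> * kummer_M (-\<alpha>/2 + 1/2) (3/2) (-\<nu>\<^sup>2) / kummer_M (-\<alpha>/2) (1/2) (-\<nu>\<^sup>2)
       * P1_c2 \<alpha> d k h0 Tinf \<nu>"

definition P1_temp :: "real \<Rightarrow> real \<Rightarrow> real \<Rightarrow> real \<Rightarrow> real \<Rightarrow> real \<Rightarrow> real \<Rightarrow> real \<Rightarrow> real" where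
  "P1_temp \<alpha> d k \<gamma> h0 Tinf =
     (let \<nu> = P1_nu \<alpha> d k \<gamma> h0 Tinf
      in similarity_temp \<alpha> d (P1_c1 \<alpha> d k h0 Tinf \<nu>) (P1_c2 \<alpha> d k h0 Tinf \<nu>))"

definition P1_front :: "real \<Rightarrow> real \<Rightarrow> real \<Rightarrow> real \<Rightarrow> real \<Rightarrow> real \<Rightarrow> real \<Rightarrow> real" where
  "P1_front \<alpha> d k \<gamma> h0 Tinf t = 2 * P1_nu \<alpha> d k \<gamma> h0 Tinf * sqrt (d * t)"

definition P3_f :: "real \<Rightarrow> real \<Rightarrow> real" where
  "P3_f \<alpha> x = inverse (kummer_M (\<alpha>/2 + 1/2) (1/2) (x\<^sup>2))"

definition P3_lam :: "real \<Rightarrow> real \<Rightarrow> real \<Rightarrow> real \<Rightarrow> real" where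
  "P3_lam \<alpha> d \<gamma> c =
     (THE x. 0 < x \<and>
        c / (\<gamma> * 2 powr \<alpha> * d powr ((\<alpha> + 1)/2)) * P3_f \<alpha> x = x powr (\<alpha> + 1))"

definition P3_c2 :: "real \<Rightarrow> real \<Rightarrow> real \<Rightarrow> real" where
  "P3_c2 d k c = - 2 * c * sqrt d / k"

definition P3_c1 :: "real \<Rightarrow> real \<Rightarrow> real \<Rightarrow> real \<Rightarrow> real \<Rightarrow> real" where
  "P3_c1 \<alpha> d k c l =
     - l * kummer_M (-\<alpha>/2 + 1/2) (3/2) (-l\<^sup>2) / kummer_M (-\<alpha>/2) (1/2) (-l\<^sup>2) * P3_c2 d k c"

definition P3_temp :: "real \<Rightarrow> real \<Rightarrow> real \<Rightarrow> real \<Rightarrow> real \<Rightarrow> real \<Rightarrow> real \<Rightarrow> real" where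
  "P3_temp \<alpha> d k \<gamma> c =
     similarity_temp \<alpha> d (P3_c1 \<alpha> d k c (P3_lam \<alpha> d \<gamma> c)) (P3_c2 d k c)"

definition P3_front :: "real \<Rightarrow> real \<Rightarrow> real \<Rightarrow> real \<Rightarrow> real \<Rightarrow> real" where
  "P3_front \<alpha> d \<gamma> c t = 2 * P3_lam \<alpha> d \<gamma> c * sqrt (d * t)"

text \<open>
  Two pairs of temperature and free boundary coincide as solutions of a free boundary problem: equal
  boundaries, and equal temperatures on the region where they are meaningful.
\<close>

definition same_solution ::
  "(real \<Rightarrow> real \<Rightarrow> real) \<Rightarrow> (real \<Rightarrow> real) \<Rightarrow> (real \<Rightarrow> real \<Rightarrow> real) \<Rightarrow> (real \<Rightarrow> real) \<Rightarrow> bool"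
where
  "same_solution U r V q \<longleftrightarrow>
     (\<forall>t\<ge>0. r t = q t) \<and> (\<forall>t>0. \<forall>x\<in>{0..r t}. U x t = V x t)"

end

theory Submission
  imports Defs "HOL-Computational_Algebra.Formal_Power_Series"
begin

text \<open>
  Write \<open>E\<close> and \<open>O\<close> for the even and the odd similarity profile
  \<open>M(-\<alpha>/2, 1/2, -\<eta>\<^sup>2)\<close> and \<open>\<eta> M(-\<alpha>/2 + 1/2, 3/2, -\<eta>\<^sup>2)\<close>. By Kummer's equation both
  solve the ordinary differential equation to which the heat equation reduces under the similarity
  ansatz (\<open>even_profile_heat\<close>, \<open>odd_profile_heat\<close>). A combination that vanishes at \<open>l\<close> gives a
  temperature that vanishes on the front \<open>2 l sqrt (d t)\<close>. Its flux at the front is determined by the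
  Wronskian \<open>E O' - O E' = exp (-\<eta>\<^sup>2)\<close>, and Kummer's transformation
  \<open>M(a, b, -z) = exp (-z) M(b - a, b, z)\<close> turns the Stefan condition into the front equation
  (\<open>P3_solution\<close>). After this transformation all coefficients of the series are nonnegative, which
  yields the positivity of the profiles and, by monotonicity, the existence and uniqueness of the
  front parameters (\<open>front_equation_unique\<close>).

  A similarity solution has temperature \<open>\<theta> t powr (\<alpha>/2)\<close> at \<open>x = 0\<close>, so for it a flux condition with
  datum \<open>c\<close> is the same as a convective condition with \<open>h0 (Tinf - \<theta>) = c\<close>
  (\<open>flux_solution_is_convective_solution\<close>). With the value of \<open>\<theta>\<close> inserted this becomes
  \<open>c (E + (2 sqrt d h0 / k) O) = h0 Tinf E\<close>, evaluated at the front parameter. Both formulas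
  for the data in the theorem are this one relation, solved for \<open>c\<close> or for \<open>h0\<close>. The relation also says that
  the two front equations agree at that point, so by uniqueness the two front parameters, and with
  them the coefficients of the two solutions, coincide (\<open>problems_equivalent\<close>).
\<close>

section \<open>Kummer's function\<close>

definition kummer_coeff :: "real \<Rightarrow> real \<Rightarrow> nat \<Rightarrow> real" where
  "kummer_coeff a b j = pochhammer a j / (pochhammer b j * fact j)"

lemma kummer_M_coeff: "kummer_M a b z = (\<Sum>j. kummer_coeff a b j * z ^ j)"
  by (simp add: kummer_M_def kummer_coeff_def)

lemma kummer_coeff_Suc:
  assumes "b > 0"
  shows "real (Suc j) * (b + real j) * kummer_coeff a b (Suc j) = (a + real j) * kummer_coeff a b j"
proof -
  have "pochhammer b j > 0" "b + real j > 0" using assms by (auto intro: pochhammer_pos)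
  moreover have "kummer_coeff a b (Suc j)
      = (a + real j) * pochhammer a j / ((b + real j) * real (Suc j) * (pochhammer b j * fact j))"
    by (simp add: kummer_coeff_def pochhammer_Suc mult_ac del: of_nat_Suc)
  ultimately show ?thesis
    by (simp add: kummer_coeff_def del: of_nat_Suc)
qed

lemma summable_kummer:
  assumes "b > 0"
  shows "summable (\<lambda>j. \<bar>kummer_coeff a b j * z ^ j\<bar>)"
proof -
  \<comment> \<open>\<open>K\<close> bounds \<open>\<bar>a + n\<bar> / (b + n)\<close>, so the ratio of successive terms is at most \<open>K \<bar>z\<bar> / (n + 1)\<close>.\<close>
  define K where "K = \<bar>a\<bar> / b + 1"
  obtain N :: nat where N: "2 * (K * \<bar>z\<bar>) < real N" using reals_Archimedean2 by blast
  have step: "\<bar>kummer_coeff a b (Suc n) * z ^ Suc n\<bar> \<le> 1/2 * \<bar>kummer_coeff a b n * z ^ n\<bar>"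
    if "n \<ge> N" for n
  proof -
    have bn: "b + real n > 0" using assms by simp
    have "\<bar>a + real n\<bar> \<le> \<bar>a\<bar> + real n" by linarith
    also have "\<dots> \<le> K * (b + real n)"
      using assms by (simp add: K_def field_simps)
    finally have 1: "\<bar>a + real n\<bar> * \<bar>z\<bar> \<le> K * (b + real n) * \<bar>z\<bar>"
      by (rule mult_right_mono) simp
    have "2 * (K * \<bar>z\<bar>) \<le> real (Suc n)" using N that by simp
    then have "2 * (K * \<bar>z\<bar>) * (b + real n) \<le> real (Suc n) * (b + real n)"
      using bn by (intro mult_right_mono) auto
    then have 2: "2 * (\<bar>a + real n\<bar> * \<bar>z\<bar>) \<le> real (Suc n) * (b + real n)"
      using 1 by (simp add: algebra_simps)
    have eq: "kummer_coeff a b (Suc n) = (a + real n) / (real (Suc n) * (b + real n)) * kummer_coeff a b n"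
      using kummer_coeff_Suc[OF assms, of n a] bn by (simp add: divide_simps mult_ac del: of_nat_Suc)
    have "\<bar>kummer_coeff a b (Suc n) * z ^ Suc n\<bar>
        = (\<bar>a + real n\<bar> * \<bar>z\<bar> / (real (Suc n) * (b + real n))) * \<bar>kummer_coeff a b n * z ^ n\<bar>"
      using bn unfolding eq by (simp add: abs_mult abs_divide del: of_nat_Suc)
    also have "\<dots> \<le> 1/2 * \<bar>kummer_coeff a b n * z ^ n\<bar>"
      using 2 bn by (intro mult_right_mono) (auto simp: divide_le_eq mult_pos_pos simp del: of_nat_Suc)
    finally show ?thesis .
  qed
  show ?thesis
    by (rule summable_ratio_test[of "1/2" N]) (use step in auto)
qed

lemma kummer_M_sums:
  assumes "b > 0"
  shows "(\<lambda>j. kummer_coeff a b j * z ^ j) sums kummer_M a b z"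
  unfolding kummer_M_coeff
  using summable_rabs_cancel[OF summable_kummer[OF assms]] by (rule summable_sums)

text \<open>
  Differentiating the series termwise shifts both parameters by one, so that all derivatives
  of \<open>M\<close> are again Kummer functions.
\<close>
lemma diffs_kummer_coeff:
  "diffs (kummer_coeff a b) j = a / b * kummer_coeff (a + 1) (b + 1) j"
proof -
  have "kummer_coeff a b (Suc j)
      = (a * pochhammer (a + 1) j) / (real (Suc j) * (b * (pochhammer (b + 1) j * fact j)))"
    by (simp add: kummer_coeff_def pochhammer_rec mult_ac del: of_nat_Suc)
  then have "real (Suc j) * kummer_coeff a b (Suc j)
      = a * pochhammer (a + 1) j / (b * (pochhammer (b + 1) j * fact j))"
    by (simp del: of_nat_Suc)
  then show ?thesis
    by (simp add: diffs_def kummer_coeff_def[of "a + 1" "b + 1"] del: of_nat_Suc)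
qed

lemma kummer_M_deriv_sums:
  assumes "b > 0"
  shows "(\<lambda>j. diffs (kummer_coeff a b) j * z ^ j) sums (a / b * kummer_M (a + 1) (b + 1) z)"
  using sums_mult[OF kummer_M_sums[of "b + 1" "a + 1" z], of "a / b"] assms
  by (simp add: diffs_kummer_coeff mult.assoc)

lemma DERIV_kummer_M:
  assumes "b > 0"
  shows "(kummer_M a b has_real_derivative a / b * kummer_M (a + 1) (b + 1) z) (at z)"
proof -
  have "((\<lambda>x. \<Sum>n. kummer_coeff a b n * x ^ n) has_field_derivative
          (\<Sum>n. diffs (kummer_coeff a b) n * z ^ n)) (at z)"
    by (rule termdiffs_strong_converges_everywhere) (rule sums_summable[OF kummer_M_sums[OF assms]])
  then show ?thesis
    using sums_unique[OF kummer_M_deriv_sums[OF assms, of a z]]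
    by (simp add: kummer_M_coeff[abs_def])
qed

text \<open>
  Kummer's equation \<open>z M'' + (b - z) M' = a M\<close>: in the coefficients it is the two-term
  recurrence \<open>kummer_coeff_Suc\<close>.
\<close>
lemma kummer_equation:
  assumes "b > 0"
  shows "z * (a / b * ((a + 1) / (b + 1) * kummer_M (a + 2) (b + 2) z))
       + (b - z) * (a / b * kummer_M (a + 1) (b + 1) z) = a * kummer_M a b z"
proof -
  let ?c = "kummer_coeff a b"
  \<comment> \<open>The operator \<open>z d/dz\<close> multiplies the \<open>j\<close>-th coefficient by \<open>j\<close>.\<close>
  have shift: "(\<lambda>j. real j * f j * z ^ j) sums (z * s)"
    if "(\<lambda>j. diffs f j * z ^ j) sums s" for f s
    using sums_mult[OF that, of z] sums_Suc_iff[of "\<lambda>j. real j * f j * z ^ j" "z * s"]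
    by (simp add: diffs_def mult_ac)
  have D: "(\<lambda>j. diffs ?c j * z ^ j) sums (a / b * kummer_M (a + 1) (b + 1) z)"
    by (rule kummer_M_deriv_sums[OF assms])
  have "(\<lambda>j. diffs (kummer_coeff (a + 1) (b + 1)) j * z ^ j)
      sums ((a + 1) / (b + 1) * kummer_M (a + 2) (b + 2) z)"
    using kummer_M_deriv_sums[of "b + 1" "a + 1" z] assms by (simp add: add.assoc)
  from shift[OF this]
  have "(\<lambda>j. a / b * (real j * kummer_coeff (a + 1) (b + 1) j * z ^ j)) sums
      (a / b * (z * ((a + 1) / (b + 1) * kummer_M (a + 2) (b + 2) z)))"
    by (rule sums_mult)
  then have "(\<lambda>j. real j * (a / b * kummer_coeff (a + 1) (b + 1) j) * z ^ j) sums
      (z * (a / b * ((a + 1) / (b + 1) * kummer_M (a + 2) (b + 2) z)))"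
    by (simp add: mult_ac)
  then have D2: "(\<lambda>j. real j * diffs ?c j * z ^ j) sums
      (z * (a / b * ((a + 1) / (b + 1) * kummer_M (a + 2) (b + 2) z)))"
    using diffs_kummer_coeff[of a b] by simp
  let ?L = "\<lambda>j. real j * diffs ?c j * z ^ j + (b * (diffs ?c j * z ^ j) - real j * ?c j * z ^ j)"
  have "?L sums (z * (a / b * ((a + 1) / (b + 1) * kummer_M (a + 2) (b + 2) z))
       + (b * (a / b * kummer_M (a + 1) (b + 1) z) - z * (a / b * kummer_M (a + 1) (b + 1) z)))"
    by (intro sums_add sums_diff sums_mult D D2 shift[OF D])
  moreover have "?L j = a * (?c j * z ^ j)" for j
  proof -
    have "?L j = (real (Suc j) * (b + real j) * ?c (Suc j) - real j * ?c j) * z ^ j"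
      by (simp add: diffs_def algebra_simps)
    also have "\<dots> = a * (?c j * z ^ j)"
      unfolding kummer_coeff_Suc[OF assms] by (simp add: algebra_simps)
    finally show ?thesis .
  qed
  ultimately show ?thesis
    using sums_unique2[OF _ sums_mult[OF kummer_M_sums[OF assms, of a z], of a]]
    unfolding left_diff_distrib by simp
qed

text \<open>
  Kummer's transformation: the Cauchy product of the series of \<open>M(a, b, -z)\<close> and \<open>exp z\<close> has the
  coefficients of \<open>M(b - a, b, z)\<close> by the Chu--Vandermonde sum.
\<close>
lemma kummer_transformation:
  assumes "b > 0"
  shows "kummer_M a b (- z) = exp (- z) * kummer_M (b - a) b z"
proof -
  let ?c = "\<lambda>j. kummer_coeff a b j * (- z) ^ j"
  let ?e = "\<lambda>j. z ^ j /\<^sub>R fact j"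
  have "(\<lambda>n. \<Sum>i\<le>n. ?c i * ?e (n - i)) sums ((\<Sum>j. ?c j) * (\<Sum>j. ?e j))"
    using summable_kummer[OF assms, of a "- z"] summable_norm_exp[of z]
    by (intro Cauchy_product_sums) simp_all
  then have 1: "(\<lambda>n. \<Sum>i\<le>n. ?c i * ?e (n - i)) sums (kummer_M a b (- z) * exp z)"
    by (simp add: kummer_M_coeff exp_def)
  have "(\<Sum>i\<le>n. ?c i * ?e (n - i)) = kummer_coeff (b - a) b n * z ^ n" for n
  proof -
    have summand: "?c i * ?e (n - i) = z ^ n / fact n *
        (pochhammer a i * pochhammer (- real n) i / (of_nat (fact i) * pochhammer b i))"
      if "i \<le> n" for i
    proof -
      have p: "pochhammer (- real n) i = (- 1) ^ i * fact n / fact (n - i)"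
      proof -
        have "real n gchoose i = fact n / (fact i * fact (n - i))"
          using that by (simp add: binomial_gbinomial[symmetric] binomial_fact)
        then show ?thesis
          by (cases "even i") (simp_all add: gbinomial_pochhammer field_simps)
      qed
      have "z ^ i * z ^ (n - i) = z ^ n" using that by (simp flip: power_add)
      then have "(- z) ^ i * z ^ (n - i) = (- 1) ^ i * z ^ n"
        by (simp add: power_minus[of z] mult.assoc)
      then show ?thesis
        unfolding p kummer_coeff_def by (simp add: field_simps)
    qed
    have "\<forall>i\<in>{0..<n}. b \<noteq> - of_nat i" using assms by auto
    then have V: "(\<Sum>i=0..n. pochhammer a i * pochhammer (- real n) i / (of_nat (fact i) * pochhammer b i))
        = pochhammer (b - a) n / pochhammer b n"
      by (rule Vandermonde_pochhammer)
    have "(\<Sum>i\<le>n. ?c i * ?e (n - i)) = (\<Sum>i=0..n. z ^ n / fact n *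
        (pochhammer a i * pochhammer (- real n) i / (of_nat (fact i) * pochhammer b i)))"
      using summand by (intro sum.cong) (auto simp: atLeast0AtMost)
    also have "\<dots> = z ^ n / fact n * (pochhammer (b - a) n / pochhammer b n)"
      unfolding sum_distrib_left[symmetric] V ..
    finally show ?thesis by (simp add: kummer_coeff_def field_simps)
  qed
  then have "kummer_M a b (- z) * exp z = kummer_M (b - a) b z"
    using 1 sums_unique2[OF _ kummer_M_sums[OF assms, of "b - a" z]] by simp
  then show ?thesis by (simp add: exp_minus field_simps)
qed

lemma kummer_coeff_nonneg: "a > 0 \<Longrightarrow> b > 0 \<Longrightarrow> kummer_coeff a b j \<ge> 0"
  by (simp add: kummer_coeff_def pochhammer_nonneg)

text \<open>
  For positive parameters the coefficients are nonnegative, so every term of the series is monotone.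
  The similarity solution evaluates \<open>M\<close> at negative arguments and at first parameters that need not
  be positive; Kummer's transformation brings it into the range covered here.
\<close>
lemma kummer_M_mono:
  assumes "a > 0" "b > 0" "0 \<le> y" "y \<le> z"
  shows "kummer_M a b y \<le> kummer_M a b z"
  by (rule sums_le[OF _ kummer_M_sums[OF assms(2)] kummer_M_sums[OF assms(2)]])
    (intro mult_left_mono power_mono kummer_coeff_nonneg assms)

lemma kummer_M_0: "kummer_M a b 0 = 1"
  using powser_zero[of "kummer_coeff a b"] by (simp add: kummer_M_coeff kummer_coeff_def)

lemma kummer_M_ge_1: "a > 0 \<Longrightarrow> b > 0 \<Longrightarrow> 0 \<le> z \<Longrightarrow> kummer_M a b z \<ge> 1"
  using kummer_M_mono[of a b 0 z] by (simp add: kummer_M_0)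

section \<open>Similarity profiles of the heat equation\<close>

text \<open>
  The equation \<open>F'' + 2 \<eta> F' = 2 \<alpha> F\<close> is what the heat equation becomes for
  \<open>t powr (\<alpha>/2) * F (x / (2 * sqrt (d * t)))\<close>. It is solved for \<open>F''\<close> here, so that the pair
  \<open>(F, F')\<close> carries everything that is needed about second derivatives.
\<close>
definition heat_profile :: "real \<Rightarrow> (real \<Rightarrow> real) \<Rightarrow> (real \<Rightarrow> real) \<Rightarrow> bool" where
  "heat_profile \<alpha> F F' \<longleftrightarrow>
     (\<forall>\<eta>. (F has_real_derivative F' \<eta>) (at \<eta>)) \<and>
     (\<forall>\<eta>. (F' has_real_derivative 2 * \<alpha> * F \<eta> - 2 * \<eta> * F' \<eta>) (at \<eta>))"

lemma heat_profileD:
  assumes "heat_profile \<alpha> F F'"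
  shows "(F has_real_derivative F' \<eta>) (at \<eta>)"
    and "(F' has_real_derivative 2 * \<alpha> * F \<eta> - 2 * \<eta> * F' \<eta>) (at \<eta>)"
  using assms by (auto simp: heat_profile_def)

lemma heat_profile_combination:
  assumes "heat_profile \<alpha> F F'" "heat_profile \<alpha> G G'"
  shows "heat_profile \<alpha> (\<lambda>\<eta>. a * F \<eta> + b * G \<eta>) (\<lambda>\<eta>. a * F' \<eta> + b * G' \<eta>)"
  unfolding heat_profile_def
  by (auto intro!: derivative_eq_intros assms[THEN heat_profileD(1)] assms[THEN heat_profileD(2)]
      simp: algebra_simps)

text \<open>
  Abel's formula. It evaluates the flux at the front: there the profile vanishes, and its
  derivative is a Wronskian of the even and the odd profile divided by the even one.
\<close>
lemma heat_profile_wronskian: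
  assumes F: "heat_profile \<alpha> F F'" and G: "heat_profile \<alpha> G G'"
  shows "F \<eta> * G' \<eta> - G \<eta> * F' \<eta> = (F 0 * G' 0 - G 0 * F' 0) * exp (- \<eta>\<^sup>2)"
proof -
  let ?W = "\<lambda>\<eta>. (F \<eta> * G' \<eta> - G \<eta> * F' \<eta>) * exp (\<eta>\<^sup>2)"
  have "(?W has_real_derivative 0) (at x)" for x
    by (rule derivative_eq_intros heat_profileD[OF F] heat_profileD[OF G] refl)+
      (simp add: algebra_simps power2_eq_square)
  then have "?W \<eta> = ?W 0" by (intro DERIV_isconst_all) auto
  then show ?thesis by (simp add: exp_minus field_simps)
qed

definition even_profile :: "real \<Rightarrow> real \<Rightarrow> real" where
  "even_profile \<alpha> \<eta> = kummer_M (-\<alpha>/2) (1/2) (-\<eta>\<^sup>2)"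

definition odd_profile :: "real \<Rightarrow> real \<Rightarrow> real" where
  "odd_profile \<alpha> \<eta> = \<eta> * kummer_M (-\<alpha>/2 + 1/2) (3/2) (-\<eta>\<^sup>2)"

text \<open>
  With \<open>z = -\<eta>\<^sup>2\<close> the profile equation is \<open>-4\<close> times Kummer's equation for \<open>a = -\<alpha>/2\<close>, \<open>b = 1/2\<close>.
\<close>
lemma even_profile_heat:
  obtains F' where "heat_profile \<alpha> (even_profile \<alpha>) F'" "F' 0 = 0"
proof
  let ?a = "-\<alpha>/2" and ?b = "1/2 :: real"
  let ?M1 = "\<lambda>z. ?a / ?b * kummer_M (?a + 1) (?b + 1) z"
  let ?M2 = "\<lambda>z. ?a / ?b * ((?a + 1) / (?b + 1) * kummer_M (?a + 2) (?b + 2) z)"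
  have D0: "(kummer_M ?a ?b has_real_derivative ?M1 z) (at z)" for z
    by (rule DERIV_kummer_M) simp
  have D1: "(?M1 has_real_derivative ?M2 z) (at z)" for z
    using DERIV_cmult[OF DERIV_kummer_M[of "?b + 1" "?a + 1" z], of "?a / ?b"] by (simp add: add.assoc)
  show "heat_profile \<alpha> (even_profile \<alpha>) (\<lambda>\<eta>. ?M1 (-\<eta>\<^sup>2) * (- 2 * \<eta>))"
    unfolding heat_profile_def
  proof (intro conjI allI)
    fix \<eta> :: real
    have q: "((\<lambda>\<eta>. - \<eta>\<^sup>2) has_real_derivative - 2 * \<eta>) (at \<eta>)"
      by (auto intro!: derivative_eq_intros)
    show "(even_profile \<alpha> has_real_derivative ?M1 (-\<eta>\<^sup>2) * (- 2 * \<eta>)) (at \<eta>)"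
      unfolding even_profile_def[abs_def] by (rule DERIV_chain2[OF D0 q])
    have "((\<lambda>\<eta>. ?M1 (-\<eta>\<^sup>2) * (- 2 * \<eta>)) has_real_derivative
        (?M2 (-\<eta>\<^sup>2) * (- 2 * \<eta>)) * (- 2 * \<eta>) + - 2 * ?M1 (-\<eta>\<^sup>2)) (at \<eta>)"
      by (rule DERIV_mult[OF DERIV_chain2[OF D1 q]]) (auto intro!: derivative_eq_intros)
    also have "(?M2 (-\<eta>\<^sup>2) * (- 2 * \<eta>)) * (- 2 * \<eta>) + - 2 * ?M1 (-\<eta>\<^sup>2)
        = 2 * \<alpha> * even_profile \<alpha> \<eta> - 2 * \<eta> * (?M1 (-\<eta>\<^sup>2) * (- 2 * \<eta>))"
    proof -
      define m0 m1 m2 where "m0 = kummer_M ?a ?b (-\<eta>\<^sup>2)" and "m1 = ?M1 (-\<eta>\<^sup>2)" and "m2 = ?M2 (-\<eta>\<^sup>2)"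
      have "(-\<eta>\<^sup>2) * m2 + (1/2 - (-\<eta>\<^sup>2)) * m1 = ?a * m0"
        unfolding m0_def m1_def m2_def by (rule kummer_equation) simp
      then show ?thesis
        unfolding even_profile_def m0_def[symmetric] m1_def[symmetric] m2_def[symmetric]
        by (simp add: algebra_simps power2_eq_square)
    qed
    finally show "((\<lambda>\<eta>. ?M1 (-\<eta>\<^sup>2) * (- 2 * \<eta>)) has_real_derivative
        2 * \<alpha> * even_profile \<alpha> \<eta> - 2 * \<eta> * (?M1 (-\<eta>\<^sup>2) * (- 2 * \<eta>))) (at \<eta>)" .
  qed
qed simp

text \<open>
  Here the profile equation is \<open>-4 \<eta>\<close> times Kummer's equation for \<open>a = (1 - \<alpha>)/2\<close>, \<open>b = 3/2\<close>;
  the factor \<open>\<eta>\<close> in front of \<open>M\<close> raises the second parameter from \<open>1/2\<close> to \<open>3/2\<close>.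
\<close>
lemma odd_profile_heat:
  obtains F' where "heat_profile \<alpha> (odd_profile \<alpha>) F'" "F' 0 = 1"
proof
  let ?a = "-\<alpha>/2 + 1/2" and ?b = "3/2 :: real"
  let ?M0 = "kummer_M ?a ?b"
  let ?M1 = "\<lambda>z. ?a / ?b * kummer_M (?a + 1) (?b + 1) z"
  let ?M2 = "\<lambda>z. ?a / ?b * ((?a + 1) / (?b + 1) * kummer_M (?a + 2) (?b + 2) z)"
  let ?F' = "\<lambda>\<eta>. ?M0 (-\<eta>\<^sup>2) - 2 * \<eta>\<^sup>2 * ?M1 (-\<eta>\<^sup>2)"
  have D0: "(?M0 has_real_derivative ?M1 z) (at z)" for z
    by (rule DERIV_kummer_M) simp
  have D1: "(?M1 has_real_derivative ?M2 z) (at z)" for z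
    using DERIV_cmult[OF DERIV_kummer_M[of "?b + 1" "?a + 1" z], of "?a / ?b"] by (simp add: add.assoc)
  show "heat_profile \<alpha> (odd_profile \<alpha>) ?F'"
    unfolding heat_profile_def
  proof (intro conjI allI)
    fix \<eta> :: real
    define m0 m1 m2 where "m0 = ?M0 (-\<eta>\<^sup>2)" and "m1 = ?M1 (-\<eta>\<^sup>2)" and "m2 = ?M2 (-\<eta>\<^sup>2)"
    have q: "((\<lambda>\<eta>. - \<eta>\<^sup>2) has_real_derivative - 2 * \<eta>) (at \<eta>)"
      by (auto intro!: derivative_eq_intros)
    have C0: "((\<lambda>\<eta>. ?M0 (-\<eta>\<^sup>2)) has_real_derivative m1 * (- 2 * \<eta>)) (at \<eta>)"
      unfolding m1_def by (rule DERIV_chain2[OF D0 q])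
    have C1: "((\<lambda>\<eta>. ?M1 (-\<eta>\<^sup>2)) has_real_derivative m2 * (- 2 * \<eta>)) (at \<eta>)"
      unfolding m2_def by (rule DERIV_chain2[OF D1 q])
    have "((\<lambda>\<eta>. \<eta> * ?M0 (-\<eta>\<^sup>2)) has_real_derivative 1 * m0 + m1 * (- 2 * \<eta>) * \<eta>) (at \<eta>)"
      unfolding m0_def by (rule DERIV_mult[OF DERIV_ident C0])
    also have "1 * m0 + m1 * (- 2 * \<eta>) * \<eta> = m0 - 2 * \<eta>\<^sup>2 * m1"
      by (simp add: power2_eq_square)
    finally show "(odd_profile \<alpha> has_real_derivative ?F' \<eta>) (at \<eta>)"
      unfolding odd_profile_def[abs_def] m0_def m1_def .
    have sq: "((\<lambda>\<eta>. 2 * \<eta>\<^sup>2) has_real_derivative 4 * \<eta>) (at \<eta>)"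
      by (auto intro!: derivative_eq_intros)
    have "(?F' has_real_derivative
        m1 * (- 2 * \<eta>) - (4 * \<eta> * m1 + m2 * (- 2 * \<eta>) * (2 * \<eta>\<^sup>2))) (at \<eta>)"
      using DERIV_diff[OF C0 DERIV_mult[OF sq C1]] unfolding m1_def .
    also have "m1 * (- 2 * \<eta>) - (4 * \<eta> * m1 + m2 * (- 2 * \<eta>) * (2 * \<eta>\<^sup>2))
        = 2 * \<alpha> * (\<eta> * m0) - 2 * \<eta> * (m0 - 2 * \<eta>\<^sup>2 * m1)"
    proof -
      have "(-\<eta>\<^sup>2) * m2 + (3/2 - (-\<eta>\<^sup>2)) * m1 = ?a * m0"
        unfolding m0_def m1_def m2_def by (rule kummer_equation) simp
      then have "-4 * \<eta> * ((-\<eta>\<^sup>2) * m2 + (3/2 - (-\<eta>\<^sup>2)) * m1) = -4 * \<eta> * (?a * m0)"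
        by simp
      then show ?thesis by (simp add: algebra_simps)
    qed
    finally show "(?F' has_real_derivative 2 * \<alpha> * odd_profile \<alpha> \<eta> - 2 * \<eta> * ?F' \<eta>) (at \<eta>)"
      unfolding odd_profile_def m0_def m1_def .
  qed
qed (simp add: kummer_M_0)

lemma even_profile_0: "even_profile \<alpha> 0 = 1" by (simp add: even_profile_def kummer_M_0)
lemma odd_profile_0: "odd_profile \<alpha> 0 = 0" by (simp add: odd_profile_def)

text \<open>
  The transformed profiles have positive first parameters, and they are what links the similarity
  solution, written with argument \<open>-\<eta>\<^sup>2\<close>, to the front equations, written with argument \<open>x\<^sup>2\<close>.
\<close>
lemma even_profile_transformed:
  "even_profile \<alpha> x = exp (- x\<^sup>2) * kummer_M (\<alpha>/2 + 1/2) (1/2) (x\<^sup>2)"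
  using kummer_transformation[of "1/2" "-\<alpha>/2" "x\<^sup>2"] by (simp add: even_profile_def add.commute)

lemma odd_profile_transformed:
  "odd_profile \<alpha> x = exp (- x\<^sup>2) * (x * kummer_M (\<alpha>/2 + 1) (3/2) (x\<^sup>2))"
  using kummer_transformation[of "3/2" "-\<alpha>/2 + 1/2" "x\<^sup>2"] by (simp add: odd_profile_def add.commute)

lemma even_profile_pos: "\<alpha> \<ge> 0 \<Longrightarrow> even_profile \<alpha> x > 0"
  using kummer_M_ge_1[of "\<alpha>/2 + 1/2" "1/2" "x\<^sup>2"] by (simp add: even_profile_transformed)

lemma odd_profile_pos: "\<alpha> \<ge> 0 \<Longrightarrow> x > 0 \<Longrightarrow> odd_profile \<alpha> x > 0"
  using kummer_M_ge_1[of "\<alpha>/2 + 1" "3/2" "x\<^sup>2"] by (simp add: odd_profile_transformed)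

section \<open>From a profile to a free boundary solution\<close>

text \<open>
  On the curve \<open>x = 2 l sqrt (d t)\<close> the similarity variable has the constant value \<open>l\<close>, so both
  conditions on the free boundary lose their dependence on time: the temperature condition becomes
  \<open>F l = 0\<close>, and in the Stefan condition both sides are multiples of \<open>t powr ((\<alpha> - 1)/2)\<close>,
  which leaves the single equation \<open>flux\<close>.
\<close>
lemma heat_profile_free_boundary:
  assumes F: "heat_profile \<alpha> F F'" and d: "d > 0" and l: "l > 0"
    and zero: "F l = 0"
    and flux: "k * F' l = - 2 * sqrt d * (\<gamma> * 2 powr \<alpha> * d powr ((\<alpha> + 1)/2)) * l powr (\<alpha> + 1)"
  shows "free_boundary_core \<alpha> d k \<gamma>
     (\<lambda>x t. t powr (\<alpha>/2) * F (x / (2 * sqrt (d * t))))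
     (\<lambda>x t. t powr ((\<alpha> - 1)/2) / (2 * sqrt d) * F' (x / (2 * sqrt (d * t))))
     (\<lambda>t. 2 * l * sqrt (d * t))"
    (is "free_boundary_core _ _ _ _ ?U ?Ux ?r")
proof -
  have half: "t powr (p - 1/2) = t powr p / sqrt t" if "t > 0" for t p :: real
    using that by (simp add: powr_diff powr_half_sqrt)
  have Ux: "?Ux x t = t powr (\<alpha>/2) * (F' (x / (2 * sqrt (d * t))) * (1 / (2 * sqrt (d * t))))"
    if "t > 0" for x t
    using that half[of t "\<alpha>/2"] by (simp add: real_sqrt_mult diff_divide_distrib)
  have DU: "((\<lambda>y. ?U y t) has_real_derivative ?Ux x t) (at x within S)" if "t > 0" for x t S
  proof -
    have e: "((\<lambda>y. y / (2 * sqrt (d * t))) has_real_derivative 1 / (2 * sqrt (d * t))) (at x)"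
      by (rule DERIV_cdivide) simp
    show ?thesis unfolding Ux[OF that]
      by (rule has_field_derivative_at_within, rule DERIV_cmult, rule DERIV_chain2[OF heat_profileD(1)[OF F] e])
  qed
  have heat: "\<exists>Ut Uxx. ((\<lambda>\<tau>. ?U x \<tau>) has_real_derivative Ut) (at t) \<and>
        ((\<lambda>y. ?Ux y t) has_real_derivative Uxx) (at x) \<and> Ut = d * Uxx" if t: "t > 0" for x t
  proof (intro exI conjI)
    define \<eta> where "\<eta> = x / (2 * sqrt (d * t))"
    have e: "((\<lambda>y. y / (2 * sqrt (d * t))) has_real_derivative 1 / (2 * sqrt (d * t))) (at x)"
      by (rule DERIV_cdivide) simp
    show "((\<lambda>y. ?Ux y t) has_real_derivative t powr ((\<alpha> - 1)/2) / (2 * sqrt d) *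
        ((2 * \<alpha> * F \<eta> - 2 * \<eta> * F' \<eta>) * (1 / (2 * sqrt (d * t))))) (at x)"
      unfolding \<eta>_def by (rule DERIV_cmult, rule DERIV_chain2[OF heat_profileD(2)[OF F] e])
    have "((\<lambda>\<tau>. x / (2 * sqrt (d * \<tau>))) has_real_derivative - \<eta> / (2 * t)) (at t)"
      unfolding \<eta>_def using t d
      by (auto intro!: derivative_eq_intros simp: field_simps mult_less_0_iff)
    from DERIV_chain2[OF heat_profileD(1)[OF F] this]
    have DF: "((\<lambda>\<tau>. F (x / (2 * sqrt (d * \<tau>)))) has_real_derivative F' \<eta> * (- \<eta> / (2 * t))) (at t)"
      unfolding \<eta>_def .
    have Dp: "((\<lambda>\<tau>. \<tau> powr (\<alpha>/2)) has_real_derivative \<alpha>/2 * t powr (\<alpha>/2 - 1)) (at t)"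
      by (rule has_real_derivative_powr[OF t])
    show "((\<lambda>\<tau>. ?U x \<tau>) has_real_derivative
        (\<alpha>/2 * t powr (\<alpha>/2 - 1)) * F \<eta> + (F' \<eta> * (- \<eta> / (2 * t))) * t powr (\<alpha>/2)) (at t)"
      using DERIV_mult[OF Dp DF] unfolding \<eta>_def .
    have p1: "t powr ((\<alpha> - 1)/2) = t powr (\<alpha>/2) / sqrt t"
      using half[OF t, of "\<alpha>/2"] by (simp add: diff_divide_distrib)
    have p2: "t powr (\<alpha>/2 - 1) = t powr (\<alpha>/2) / t"
      using t by (simp add: powr_diff)
    \<comment> \<open>The heat equation with \<open>u\<^sup>2 = d\<close>, \<open>v\<^sup>2 = t\<close> and \<open>p = t powr (\<alpha>/2)\<close>.\<close>
    have "(\<alpha>/2 * (p / (v * v))) * F \<eta> + (F' \<eta> * (- \<eta> / (2 * (v * v)))) * p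
      = (u * u) * (p / v / (2 * u) * ((2 * \<alpha> * F \<eta> - 2 * \<eta> * F' \<eta>) * (1 / (2 * (u * v)))))"
      if "u > 0" "v > 0" for u v p :: real
      using that by (simp add: field_simps)
    from this[of "sqrt d" "sqrt t" "t powr (\<alpha>/2)"]
    show "(\<alpha>/2 * t powr (\<alpha>/2 - 1)) * F \<eta> + (F' \<eta> * (- \<eta> / (2 * t))) * t powr (\<alpha>/2)
      = d * (t powr ((\<alpha> - 1)/2) / (2 * sqrt d) *
        ((2 * \<alpha> * F \<eta> - 2 * \<eta> * F' \<eta>) * (1 / (2 * sqrt (d * t)))))"
      unfolding p1 p2 using d t by (simp add: real_sqrt_mult)
  qed
  have at_front: "?r t / (2 * sqrt (d * t)) = l" if "t > 0" for t
    using that d by simp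
  have stefan: "\<exists>r'. (?r has_real_derivative r') (at t) \<and>
        k * ?Ux (?r t) t = - \<gamma> * ?r t powr \<alpha> * r'" if t: "t > 0" for t
  proof (intro exI conjI)
    show "(?r has_real_derivative l * sqrt d / sqrt t) (at t)"
      using t d by (auto intro!: derivative_eq_intros simp: real_sqrt_mult field_simps)
    have s: "sqrt d = d powr (1/2)" "sqrt t = t powr (1/2)" using d t by (auto simp: powr_half_sqrt)
    have r: "?r t powr \<alpha> = 2 powr \<alpha> * l powr \<alpha> * (d powr (\<alpha>/2) * t powr (\<alpha>/2))"
      using d t l by (simp add: real_sqrt_mult s powr_mult powr_powr)
    have "k * ?Ux (?r t) t = t powr ((\<alpha> - 1)/2) / (2 * sqrt d) * (k * F' l)"
      unfolding at_front[OF t] by simp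
    also have "\<dots> = - \<gamma> * ?r t powr \<alpha> * (l * sqrt d / sqrt t)"
    proof -
      have "t powr ((\<alpha> - 1)/2) = t powr (\<alpha>/2) / sqrt t"
        using half[OF t, of "\<alpha>/2"] by (simp add: diff_divide_distrib)
      moreover have "d powr ((\<alpha> + 1)/2) = d powr (\<alpha>/2) * sqrt d"
        unfolding s by (simp add: add_divide_distrib powr_add)
      ultimately show ?thesis
        unfolding flux r using d t l
        by (simp add: powr_add field_simps)
    qed
    finally show "k * ?Ux (?r t) t = - \<gamma> * ?r t powr \<alpha> * (l * sqrt d / sqrt t)" .
  qed
  show ?thesis
    unfolding free_boundary_core_def
    using DU heat at_front stefan zero l d by (simp del: mult_eq_0_iff)
qed

section \<open>The front parameter\<close>

text \<open>
  Multiplied by \<open>P x\<close>, the equation says that \<open>x powr p * P x\<close> takes the value \<open>K\<close>. This function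
  is strictly increasing, vanishes at 0, and is at least \<open>x powr p\<close>, so it has reached \<open>K\<close> by
  \<open>x = K powr (1/p)\<close>.
\<close>
lemma front_equation_unique:
  fixes P :: "real \<Rightarrow> real"
  assumes K: "K > 0" and p: "p > 0" and cont: "continuous_on {0..} P"
    and mono: "mono_on {0..} P" and ge1: "\<And>x. x \<ge> 0 \<Longrightarrow> P x \<ge> 1"
  shows "\<exists>!x. 0 < x \<and> K * inverse (P x) = x powr p"
proof -
  let ?g = "\<lambda>x. x powr p * P x"
  have eq: "K * inverse (P x) = x powr p \<longleftrightarrow> ?g x = K" if "x > 0" for x
    using ge1[of x] that by (auto simp: field_simps)
  have less: "?g x < ?g y" if "0 < x" "x < y" for x y
  proof -
    have "x powr p * P x < y powr p * P x"
      using that p ge1[of x] by (intro mult_strict_right_mono powr_less_mono2) auto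
    also have "\<dots> \<le> y powr p * P y"
      using that mono_onD[OF mono, of x y] by (intro mult_left_mono) auto
    finally show ?thesis .
  qed
  have "K \<le> ?g (K powr (1 / p))"
    using K p ge1[of "K powr (1 / p)"] by (simp add: powr_powr)
  moreover have "continuous_on {0..K powr (1 / p)} ?g"
    using p by (intro continuous_intros continuous_on_powr' continuous_on_subset[OF cont]) auto
  ultimately obtain x where "0 \<le> x" "?g x = K"
    using IVT'[of ?g 0 K "K powr (1 / p)"] K p by auto
  moreover from this have "x \<noteq> 0" using K by auto
  ultimately have "0 < x \<and> K * inverse (P x) = x powr p" using eq by auto
  moreover have "y = x" if "0 < y \<and> K * inverse (P y) = y powr p"
      "0 < x \<and> K * inverse (P x) = x powr p" for x y
    using that eq less[of x y] less[of y x] by (metis linorder_neqE order_less_irrefl)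
  ultimately show ?thesis by blast
qed

lemma kummer_M_square_cont: "b > 0 \<Longrightarrow> continuous_on S (\<lambda>x. kummer_M a b (x\<^sup>2))"
  by (rule continuous_on_compose2[of UNIV "kummer_M a b"])
    (auto intro!: continuous_at_imp_continuous_on DERIV_isCont[OF DERIV_kummer_M] continuous_intros)

lemma P1_front_equation:
  assumes "\<alpha> \<ge> 0" "d > 0" "k > 0" "\<gamma> > 0" "h0 > 0" "Tinf > 0"
  shows "\<exists>!x. 0 < x \<and>
    h0 * Tinf / (\<gamma> * 2 powr \<alpha> * d powr ((\<alpha> + 1)/2)) * P1_f \<alpha> d k h0 x = x powr (\<alpha> + 1)"
  unfolding P1_f_def
proof (rule front_equation_unique)
  show "continuous_on {0..} (\<lambda>x. kummer_M (\<alpha>/2 + 1/2) (1/2) (x\<^sup>2)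
              + 2 * (sqrt d * h0 / k) * x * kummer_M (\<alpha>/2 + 1) (3/2) (x\<^sup>2))"
    by (intro continuous_intros kummer_M_square_cont) auto
  show "mono_on {0..} (\<lambda>x. kummer_M (\<alpha>/2 + 1/2) (1/2) (x\<^sup>2)
              + 2 * (sqrt d * h0 / k) * x * kummer_M (\<alpha>/2 + 1) (3/2) (x\<^sup>2))"
    using assms kummer_M_ge_1[of "\<alpha>/2 + 1" "3/2"]
    by (intro mono_onI add_mono mult_mono kummer_M_mono power_mono)
      (auto intro: order_trans[OF zero_le_one])
  show "kummer_M (\<alpha>/2 + 1/2) (1/2) (x\<^sup>2)
              + 2 * (sqrt d * h0 / k) * x * kummer_M (\<alpha>/2 + 1) (3/2) (x\<^sup>2) \<ge> 1" if "x \<ge> 0" for x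
  proof -
    have "kummer_M (\<alpha>/2 + 1) (3/2) (x\<^sup>2) \<ge> 0"
      using kummer_M_ge_1[of "\<alpha>/2 + 1" "3/2" "x\<^sup>2"] assms by simp
    then have "2 * (sqrt d * h0 / k) * x * kummer_M (\<alpha>/2 + 1) (3/2) (x\<^sup>2) \<ge> 0"
      using assms that by (intro mult_nonneg_nonneg) auto
    then show ?thesis using kummer_M_ge_1[of "\<alpha>/2 + 1/2" "1/2" "x\<^sup>2"] assms by simp
  qed
qed (use assms in auto)

lemma P3_front_equation:
  assumes "\<alpha> \<ge> 0" "d > 0" "\<gamma> > 0" "c > 0"
  shows "\<exists>!x. 0 < x \<and>
    c / (\<gamma> * 2 powr \<alpha> * d powr ((\<alpha> + 1)/2)) * P3_f \<alpha> x = x powr (\<alpha> + 1)"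
  unfolding P3_f_def
  using assms
  by (intro front_equation_unique kummer_M_square_cont kummer_M_ge_1)
    (auto intro!: mono_onI kummer_M_mono power_mono)

text \<open>
  Both front functions share the factor \<open>exp (-x\<^sup>2)\<close> when written in terms of the profiles; it
  cancels when the two front equations are compared.
\<close>
lemma P3_f_profile: "P3_f \<alpha> x = exp (- x\<^sup>2) / even_profile \<alpha> x"
proof -
  have "inverse m = e / (e * m)" if "e \<noteq> 0" for e m :: real
    using that by (simp add: divide_inverse)
  then show ?thesis
    unfolding P3_f_def even_profile_transformed using exp_not_eq_zero by blast
qed

lemma P1_f_profile:
  "P1_f \<alpha> d k h0 x = exp (- x\<^sup>2) / (even_profile \<alpha> x + 2 * sqrt d * h0 / k * odd_profile \<alpha> x)"
proof -
  have "inverse (m + 2 * (sqrt d * h0 / k) * x * n) = e / (e * m + 2 * sqrt d * h0 / k * (e * (x * n)))"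
    if "e \<noteq> 0" for e m n :: real
  proof -
    have "e * m + 2 * sqrt d * h0 / k * (e * (x * n)) = e * (m + 2 * (sqrt d * h0 / k) * x * n)"
      by (simp add: distrib_left)
    then show ?thesis using that by (simp add: divide_inverse)
  qed
  from this[OF exp_not_eq_zero] show ?thesis
    unfolding P1_f_def even_profile_transformed odd_profile_transformed .
qed

section \<open>Solutions of the two problems\<close>

lemma similarity_temp_profile:
  "similarity_temp \<alpha> d c1 c2 = (\<lambda>x t. t powr (\<alpha>/2) *
     (c1 * even_profile \<alpha> (x / (2 * sqrt (d * t))) + c2 * odd_profile \<alpha> (x / (2 * sqrt (d * t)))))"
  by (simp add: fun_eq_iff similarity_temp_def Let_def even_profile_def odd_profile_def mult.assoc)

lemma P3_c1_profile: "P3_c1 \<alpha> d k c l = - odd_profile \<alpha> l / even_profile \<alpha> l * P3_c2 d k c"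
  by (simp add: P3_c1_def even_profile_def odd_profile_def)

text \<open>
  The combination of the two profiles that vanishes at \<open>l\<close> has derivative \<open>c2 * P3_f \<alpha> l\<close> there by
  the Wronskian formula, so the Stefan condition is exactly the equation that defines \<open>l\<close>. At the
  fixed face only the odd profile contributes to the derivative, which makes the flux there
  a multiple of \<open>c2\<close>.
\<close>
lemma P3_solution:
  assumes "\<alpha> \<ge> 0" "d > 0" "k > 0" "\<gamma> > 0" "c > 0"
  shows "solves_P3 \<alpha> d k \<gamma> c (P3_temp \<alpha> d k \<gamma> c) (P3_front \<alpha> d \<gamma> c)"
proof -
  define l where "l = P3_lam \<alpha> d \<gamma> c"
  define G where "G = \<gamma> * 2 powr \<alpha> * d powr ((\<alpha> + 1)/2)"
  have "G > 0" using assms by (simp add: G_def)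
  have "0 < l \<and> c / G * P3_f \<alpha> l = l powr (\<alpha> + 1)"
    using theI'[OF P3_front_equation[OF assms(1,2,4,5)]] by (simp add: l_def P3_lam_def G_def)
  with \<open>G > 0\<close> have l: "l > 0" and front: "c * P3_f \<alpha> l = G * l powr (\<alpha> + 1)"
    by (auto simp: field_simps)
  obtain E' O' where E: "heat_profile \<alpha> (even_profile \<alpha>) E'" "E' 0 = 0"
    and O: "heat_profile \<alpha> (odd_profile \<alpha>) O'" "O' 0 = 1"
    using even_profile_heat odd_profile_heat by metis
  have pos: "even_profile \<alpha> l > 0" using assms(1) by (rule even_profile_pos)
  define c2 where "c2 = P3_c2 d k c"
  define c1 where "c1 = P3_c1 \<alpha> d k c l"
  have c1: "c1 = - odd_profile \<alpha> l / even_profile \<alpha> l * c2"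
    unfolding c1_def c2_def by (rule P3_c1_profile)
  let ?F' = "\<lambda>\<eta>. c1 * E' \<eta> + c2 * O' \<eta>"
  have "even_profile \<alpha> l * O' l - odd_profile \<alpha> l * E' l = exp (- l\<^sup>2)"
    using heat_profile_wronskian[OF E(1) O(1), of l] E(2) O(2)
    by (simp add: even_profile_0 odd_profile_0)
  moreover have "?F' l = c2 * (even_profile \<alpha> l * O' l - odd_profile \<alpha> l * E' l) / even_profile \<alpha> l"
    using pos by (simp add: c1 field_simps)
  ultimately have "?F' l = c2 * P3_f \<alpha> l" by (simp add: P3_f_profile)
  then have "k * ?F' l = - 2 * sqrt d * (c * P3_f \<alpha> l)"
    using assms by (simp add: c2_def P3_c2_def)
  then have flux: "k * ?F' l = - 2 * sqrt d * G * l powr (\<alpha> + 1)"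
    unfolding front by simp
  have "free_boundary_core \<alpha> d k \<gamma> (similarity_temp \<alpha> d c1 c2)
     (\<lambda>x t. t powr ((\<alpha> - 1)/2) / (2 * sqrt d) * ?F' (x / (2 * sqrt (d * t)))) (\<lambda>t. 2 * l * sqrt (d * t))"
    unfolding similarity_temp_profile
    by (rule heat_profile_free_boundary[OF heat_profile_combination[OF E(1) O(1)]])
      (use assms l flux pos in \<open>simp_all add: c1 G_def\<close>)
  moreover have "k * (t powr ((\<alpha> - 1)/2) / (2 * sqrt d) * ?F' (0 / (2 * sqrt (d * t))))
      = - c * t powr ((\<alpha> - 1)/2)" for t
    using assms by (simp add: E(2) O(2) c2_def P3_c2_def)
  ultimately show ?thesis
    unfolding solves_P3_def P3_temp_def P3_front_def[abs_def] l_def[symmetric] c1_def[symmetric]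
      c2_def[symmetric] by blast
qed

text \<open>
  The two problems differ only in the condition at \<open>x = 0\<close>. When the temperature there is
  \<open>\<theta> * t powr (\<alpha>/2)\<close>, the convective flux is a constant multiple of \<open>t powr ((\<alpha> - 1)/2)\<close>, hence
  a flux condition whose datum is the heat transfer coefficient times the gap \<open>Tinf - \<theta>\<close>.
\<close>
lemma flux_solution_is_convective_solution:
  assumes P3: "solves_P3 \<alpha> d k \<gamma> c T q" and face: "\<And>t. t > 0 \<Longrightarrow> T 0 t = t powr (\<alpha>/2) * \<theta>"
    and h0: "h0 * (Tinf - \<theta>) = c"
  shows "solves_P1 \<alpha> d k \<gamma> h0 Tinf T q"
proof -
  obtain Tx where core: "free_boundary_core \<alpha> d k \<gamma> T Tx q"
    and flux: "\<forall>t>0. k * Tx 0 t = - c * t powr ((\<alpha> - 1)/2)"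
    using P3 by (auto simp: solves_P3_def)
  have "k * Tx 0 t = h0 * t powr (-1/2) * (T 0 t - Tinf * t powr (\<alpha>/2))" if "t > 0" for t
  proof -
    have "k * Tx 0 t = - (h0 * (Tinf - \<theta>)) * t powr ((\<alpha> - 1)/2)"
      using flux that h0 by simp
    also have "t powr ((\<alpha> - 1)/2) = t powr (-1/2) * t powr (\<alpha>/2)"
      by (simp add: diff_divide_distrib flip: powr_add)
    also have "- (h0 * (Tinf - \<theta>)) * (t powr (-1/2) * t powr (\<alpha>/2))
        = h0 * t powr (-1/2) * (t powr (\<alpha>/2) * \<theta> - Tinf * t powr (\<alpha>/2))"
      by (simp add: algebra_simps)
    finally show ?thesis unfolding face[OF that] .
  qed
  with core show ?thesis by (auto simp: solves_P1_def)
qed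

section \<open>The equivalence\<close>

text \<open>
  The relation \<open>balance\<close> between the data says that the left-hand sides of the two front equations
  agree at the point \<open>x\<close>. A root of one equation is then a root of the other, and uniqueness
  identifies it with the front parameter of the other problem.
\<close>
lemma fronts_agree:
  assumes "\<alpha> \<ge> 0" "d > 0" "k > 0" "\<gamma> > 0" "h0 > 0" "Tinf > 0" "c > 0"
    and x: "x = P1_nu \<alpha> d k \<gamma> h0 Tinf \<or> x = P3_lam \<alpha> d \<gamma> c"
    and balance: "c * (even_profile \<alpha> x + 2 * sqrt d * h0 / k * odd_profile \<alpha> x)
      = h0 * Tinf * even_profile \<alpha> x"
  shows "x = P1_nu \<alpha> d k \<gamma> h0 Tinf" "x = P3_lam \<alpha> d \<gamma> c" "x > 0"
proof -
  let ?G = "\<gamma> * 2 powr \<alpha> * d powr ((\<alpha> + 1)/2)"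
  let ?P1 = "\<lambda>x. 0 < x \<and> h0 * Tinf / ?G * P1_f \<alpha> d k h0 x = x powr (\<alpha> + 1)"
  let ?P3 = "\<lambda>x. 0 < x \<and> c / ?G * P3_f \<alpha> x = x powr (\<alpha> + 1)"
  note ex1 = P1_front_equation[OF assms(1-6)]
  note ex3 = P3_front_equation[OF assms(1,2,4,7)]
  have "x > 0"
    using x theI'[OF ex1] theI'[OF ex3] by (auto simp: P1_nu_def P3_lam_def)
  have E: "even_profile \<alpha> x > 0" and "odd_profile \<alpha> x > 0"
    using even_profile_pos odd_profile_pos assms(1) \<open>x > 0\<close> by auto
  then have "even_profile \<alpha> x + 2 * sqrt d * h0 / k * odd_profile \<alpha> x > 0"
    using assms by (intro add_pos_pos mult_pos_pos divide_pos_pos) auto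
  then have same: "h0 * Tinf * P1_f \<alpha> d k h0 x = c * P3_f \<alpha> x"
    using E balance unfolding P1_f_profile P3_f_profile by (simp add: frac_eq_eq mult_ac)
  then have "?P1 x \<longleftrightarrow> ?P3 x" by simp
  moreover have "?P1 x \<or> ?P3 x"
    using x theI'[OF ex1] theI'[OF ex3] by (auto simp: P1_nu_def P3_lam_def)
  ultimately have "?P1 x" "?P3 x" by auto
  then show "x = P1_nu \<alpha> d k \<gamma> h0 Tinf" "x = P3_lam \<alpha> d \<gamma> c" "x > 0"
    using the1_equality[OF ex1] the1_equality[OF ex3] by (auto simp: P1_nu_def P3_lam_def)
qed

text \<open>
  Solving \<open>balance\<close> for \<open>c\<close> gives the formula for the flux datum in terms of the convective data,
  and solving it for \<open>h0\<close> gives the formula in the opposite direction. This is why one lemma serves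
  both directions of the equivalence, which differ only in the problem that \<open>x\<close> comes from.
\<close>
lemma problems_equivalent:
  assumes "\<alpha> \<ge> 0" "d > 0" "k > 0" "\<gamma> > 0" "h0 > 0" "Tinf > 0" "c > 0"
    and "x = P1_nu \<alpha> d k \<gamma> h0 Tinf \<or> x = P3_lam \<alpha> d \<gamma> c"
    and balance: "c * (even_profile \<alpha> x + 2 * sqrt d * h0 / k * odd_profile \<alpha> x)
      = h0 * Tinf * even_profile \<alpha> x"
  shows "P1_temp \<alpha> d k \<gamma> h0 Tinf = P3_temp \<alpha> d k \<gamma> c"
    and "P1_front \<alpha> d k \<gamma> h0 Tinf = P3_front \<alpha> d \<gamma> c"
    and "solves_P1 \<alpha> d k \<gamma> h0 Tinf (P3_temp \<alpha> d k \<gamma> c) (P3_front \<alpha> d \<gamma> c)"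
proof -
  note x = fronts_agree[OF assms]
  have E: "even_profile \<alpha> x > 0" and O: "odd_profile \<alpha> x > 0"
    using even_profile_pos odd_profile_pos assms(1) x(3) by auto
  have denom: "k * even_profile \<alpha> x + 2 * sqrt d * h0 * odd_profile \<alpha> x > 0"
    using E O assms by (intro add_pos_pos mult_pos_pos) auto
  have balance': "c * (k * even_profile \<alpha> x + 2 * sqrt d * h0 * odd_profile \<alpha> x)
      = k * (h0 * Tinf * even_profile \<alpha> x)"
    using balance \<open>k > 0\<close> by (simp add: field_simps)
  have "P1_c2 \<alpha> d k h0 Tinf x
      = - 2 * sqrt d * (h0 * Tinf * even_profile \<alpha> x) / (k * even_profile \<alpha> x + 2 * sqrt d * h0 * odd_profile \<alpha> x)"
    by (simp add: P1_c2_def even_profile_def odd_profile_def mult_ac)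
  also have "h0 * Tinf * even_profile \<alpha> x
      = c * (k * even_profile \<alpha> x + 2 * sqrt d * h0 * odd_profile \<alpha> x) / k"
    using balance' \<open>k > 0\<close> by (simp add: field_simps)
  finally have c2: "P1_c2 \<alpha> d k h0 Tinf x = P3_c2 d k c"
    using denom by (simp add: P3_c2_def)
  then have c1: "P1_c1 \<alpha> d k h0 Tinf x = P3_c1 \<alpha> d k c x"
    by (simp add: P1_c1_def P3_c1_def)
  show "P1_temp \<alpha> d k \<gamma> h0 Tinf = P3_temp \<alpha> d k \<gamma> c"
    unfolding P1_temp_def P3_temp_def Let_def x(1,2)[symmetric] c1 c2 ..
  show "P1_front \<alpha> d k \<gamma> h0 Tinf = P3_front \<alpha> d \<gamma> c"
    by (simp add: fun_eq_iff P1_front_def P3_front_def flip: x(1,2))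
  show "solves_P1 \<alpha> d k \<gamma> h0 Tinf (P3_temp \<alpha> d k \<gamma> c) (P3_front \<alpha> d \<gamma> c)"
  proof (rule flux_solution_is_convective_solution[OF P3_solution[OF assms(1-4,7)]])
    show "P3_temp \<alpha> d k \<gamma> c 0 t = t powr (\<alpha>/2) * P3_c1 \<alpha> d k c x" for t
      by (simp add: P3_temp_def similarity_temp_profile even_profile_0 odd_profile_0 flip: x(2))
    \<comment> \<open>At the fixed face the even profile is 1 and the odd one is 0, so \<open>P3_c1\<close> is the temperature there.\<close>
    show "h0 * (Tinf - P3_c1 \<alpha> d k c x) = c"
      using E \<open>k > 0\<close> balance' by (simp add: P3_c1_profile P3_c2_def field_simps)
  qed
qed

theorem theorem3p2:
  fixes \<alpha> d k \<gamma> :: real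
  assumes "\<alpha> \<ge> 0" and "d > 0" and "k > 0" and "\<gamma> > 0"
  shows
    "(\<forall>h0 Tinf \<nu> c :: real.
        h0 > 0 \<longrightarrow> Tinf > 0 \<longrightarrow>
        \<nu> = P1_nu \<alpha> d k \<gamma> h0 Tinf \<longrightarrow>
        c = h0 * Tinf * kummer_M (-\<alpha>/2) (1/2) (-\<nu>\<^sup>2) /
              (kummer_M (-\<alpha>/2) (1/2) (-\<nu>\<^sup>2)
               + 2 * sqrt d * h0 / k * \<nu> * kummer_M (-\<alpha>/2 + 1/2) (3/2) (-\<nu>\<^sup>2)) \<longrightarrow>
        c > 0 \<and>
        solves_P1 \<alpha> d k \<gamma> h0 Tinf (P1_temp \<alpha> d k \<gamma> h0 Tinf) (P1_front \<alpha> d k \<gamma> h0 Tinf) \<and>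
        solves_P3 \<alpha> d k \<gamma> c (P3_temp \<alpha> d k \<gamma> c) (P3_front \<alpha> d \<gamma> c) \<and>
        same_solution (P3_temp \<alpha> d k \<gamma> c) (P3_front \<alpha> d \<gamma> c)
                      (P1_temp \<alpha> d k \<gamma> h0 Tinf) (P1_front \<alpha> d k \<gamma> h0 Tinf))
   \<and> (\<forall>c l Tinf h0 :: real.
        c > 0 \<longrightarrow>
        l = P3_lam \<alpha> d \<gamma> c \<longrightarrow>
        Tinf > 2 * c * sqrt d / k *
               (l * kummer_M (-\<alpha>/2 + 1/2) (3/2) (-l\<^sup>2) / kummer_M (-\<alpha>/2) (1/2) (-l\<^sup>2)) \<longrightarrow>
        h0 = - c * kummer_M (-\<alpha>/2) (1/2) (-l\<^sup>2) /
              (2 * c * sqrt d / k * l * kummer_M (-\<alpha>/2 + 1/2) (3/2) (-l\<^sup>2)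
               - Tinf * kummer_M (-\<alpha>/2) (1/2) (-l\<^sup>2)) \<longrightarrow>
        h0 > 0 \<and> Tinf > 0 \<and>
        solves_P3 \<alpha> d k \<gamma> c (P3_temp \<alpha> d k \<gamma> c) (P3_front \<alpha> d \<gamma> c) \<and>
        solves_P1 \<alpha> d k \<gamma> h0 Tinf (P1_temp \<alpha> d k \<gamma> h0 Tinf) (P1_front \<alpha> d k \<gamma> h0 Tinf) \<and>
        same_solution (P1_temp \<alpha> d k \<gamma> h0 Tinf) (P1_front \<alpha> d k \<gamma> h0 Tinf)
                      (P3_temp \<alpha> d k \<gamma> c) (P3_front \<alpha> d \<gamma> c))"
proof (intro conjI[of "All _"] allI impI)
  fix h0 Tinf \<nu> c :: real
  assume pos: "h0 > 0" "Tinf > 0" and \<nu>: "\<nu> = P1_nu \<alpha> d k \<gamma> h0 Tinf"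
    and "c = h0 * Tinf * kummer_M (-\<alpha>/2) (1/2) (-\<nu>\<^sup>2) /
              (kummer_M (-\<alpha>/2) (1/2) (-\<nu>\<^sup>2)
               + 2 * sqrt d * h0 / k * \<nu> * kummer_M (-\<alpha>/2 + 1/2) (3/2) (-\<nu>\<^sup>2))"
  then have c: "c = h0 * Tinf * even_profile \<alpha> \<nu> /
      (even_profile \<alpha> \<nu> + 2 * sqrt d * h0 / k * odd_profile \<alpha> \<nu>)"
    by (simp add: even_profile_def odd_profile_def mult.assoc)
  have "\<nu> > 0"
    using theI'[OF P1_front_equation[OF assms pos]] by (simp add: \<nu> P1_nu_def)
  then have E: "even_profile \<alpha> \<nu> > 0" and "odd_profile \<alpha> \<nu> > 0"
    using even_profile_pos odd_profile_pos assms(1) by auto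
  then have denom: "even_profile \<alpha> \<nu> + 2 * sqrt d * h0 / k * odd_profile \<alpha> \<nu> > 0"
    using assms pos by (intro add_pos_pos mult_pos_pos divide_pos_pos) auto
  have "c > 0"
    unfolding c using E denom pos by (intro divide_pos_pos mult_pos_pos)
  have "c * (even_profile \<alpha> \<nu> + 2 * sqrt d * h0 / k * odd_profile \<alpha> \<nu>) = h0 * Tinf * even_profile \<alpha> \<nu>"
    using c denom by simp
  note equiv = problems_equivalent[OF assms pos \<open>c > 0\<close> disjI1[OF \<nu>] this]
  show "c > 0 \<and>
      solves_P1 \<alpha> d k \<gamma> h0 Tinf (P1_temp \<alpha> d k \<gamma> h0 Tinf) (P1_front \<alpha> d k \<gamma> h0 Tinf) \<and>
      solves_P3 \<alpha> d k \<gamma> c (P3_temp \<alpha> d k \<gamma> c) (P3_front \<alpha> d \<gamma> c) \<and>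
      same_solution (P3_temp \<alpha> d k \<gamma> c) (P3_front \<alpha> d \<gamma> c)
                    (P1_temp \<alpha> d k \<gamma> h0 Tinf) (P1_front \<alpha> d k \<gamma> h0 Tinf)"
    using \<open>c > 0\<close> equiv(3) P3_solution[OF assms \<open>c > 0\<close>]
    by (simp add: equiv(1,2) same_solution_def)
next
  fix c l Tinf h0 :: real
  assume c: "c > 0" and l: "l = P3_lam \<alpha> d \<gamma> c"
    and "Tinf > 2 * c * sqrt d / k *
               (l * kummer_M (-\<alpha>/2 + 1/2) (3/2) (-l\<^sup>2) / kummer_M (-\<alpha>/2) (1/2) (-l\<^sup>2))"
    and "h0 = - c * kummer_M (-\<alpha>/2) (1/2) (-l\<^sup>2) /
              (2 * c * sqrt d / k * l * kummer_M (-\<alpha>/2 + 1/2) (3/2) (-l\<^sup>2)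
               - Tinf * kummer_M (-\<alpha>/2) (1/2) (-l\<^sup>2))"
  then have Tinf: "Tinf > 2 * c * sqrt d / k * (odd_profile \<alpha> l / even_profile \<alpha> l)"
    and "h0 = - c * even_profile \<alpha> l /
      (2 * c * sqrt d / k * odd_profile \<alpha> l - Tinf * even_profile \<alpha> l)"
    by (simp_all add: even_profile_def odd_profile_def mult.assoc)
  then have h0: "h0 = c * even_profile \<alpha> l /
      (Tinf * even_profile \<alpha> l - 2 * c * sqrt d / k * odd_profile \<alpha> l)"
    by (metis minus_diff_eq minus_divide_divide mult_minus_left)
  have "l > 0"
    using theI'[OF P3_front_equation[OF assms(1,2,4) c]] by (simp add: l P3_lam_def)
  then have E: "even_profile \<alpha> l > 0" and O: "odd_profile \<alpha> l > 0"
    using even_profile_pos odd_profile_pos assms(1) by auto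
  \<comment> \<open>The lower bound on \<open>Tinf\<close> is the positivity of the denominator of \<open>h0\<close>.\<close>
  have denom: "Tinf * even_profile \<alpha> l - 2 * c * sqrt d / k * odd_profile \<alpha> l > 0"
    using mult_strict_right_mono[OF Tinf E] E by simp
  have "2 * c * sqrt d / k * (odd_profile \<alpha> l / even_profile \<alpha> l) > 0"
    using E O assms c by (intro mult_pos_pos divide_pos_pos) auto
  with Tinf have "Tinf > 0" by linarith
  have "h0 > 0"
    unfolding h0 using E denom c by (intro divide_pos_pos mult_pos_pos)
  have "h0 * (Tinf * even_profile \<alpha> l - 2 * c * sqrt d / k * odd_profile \<alpha> l) = c * even_profile \<alpha> l"
    using h0 denom by simp
  then have "c * (even_profile \<alpha> l + 2 * sqrt d * h0 / k * odd_profile \<alpha> l) = h0 * Tinf * even_profile \<alpha> l"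
    by (simp add: algebra_simps)
  note equiv = problems_equivalent[OF assms \<open>h0 > 0\<close> \<open>Tinf > 0\<close> c disjI2[OF l] this]
  show "h0 > 0 \<and> Tinf > 0 \<and>
      solves_P3 \<alpha> d k \<gamma> c (P3_temp \<alpha> d k \<gamma> c) (P3_front \<alpha> d \<gamma> c) \<and>
      solves_P1 \<alpha> d k \<gamma> h0 Tinf (P1_temp \<alpha> d k \<gamma> h0 Tinf) (P1_front \<alpha> d k \<gamma> h0 Tinf) \<and>
      same_solution (P1_temp \<alpha> d k \<gamma> h0 Tinf) (P1_front \<alpha> d k \<gamma> h0 Tinf)
                    (P3_temp \<alpha> d k \<gamma> c) (P3_front \<alpha> d \<gamma> c)"
    using \<open>h0 > 0\<close> \<open>Tinf > 0\<close> equiv(3) P3_solution[OF assms c]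
    by (simp add: equiv(1,2) same_solution_def)
qed

end
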